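(* Let $N=\{1,\dots,n\}$ be a finite set of players. The LRM solution $R_{\mathrm{LRM}}:\mathcal{SG}^N\to\mathcal{T}^N$ satisfies desirable monotonicity: for every simple game $v\in\mathcal{SG}^N$ and all $i,j\in N$, if $i\sim^v j$ then $i\, I_{\mathrm{LRM}}^v\, j$, and if $i\succ^v j$ then $i\, P_{\mathrm{LRM}}^v\, j$.
   Context: A simple game on $N=\{1,\dots,n\}$ is a function $v:2^N\to\{0,1\}$ with $v(\varnothing)=0$, $v(N)=1$ and $v(S)\le v(T)$ whenever $S\subseteq T\subseteq N$; $\mathcal{SG}^N$ is the set of simple games on $N$. A coalition $S\subseteq N$ is winning if $v(S)=1$; $\mathcal{W}^v$ is the set of winning coalitions and $\mathcal{W}^v_{\min}$ is the set of inclusion-minimal elements of $\mathcal{W}^v$. $\mathcal{T}^N$ is the set of total preorders (reflexive, transitive, total binary relations) on $N$. LRM solution: for $i\in N$ and $k\in\{1,\dots,n\}$ let $i_k=|\{S\in\mathcal{W}^v_{\min}: i\in S, |S|=k\}|$ and $\theta_v(i)=(i_1,\dots,i_n)$. For real vectors, $\mathbf{x}\ge_L\mathbf{y}$ means that either $\mathbf{x}=\mathbf{y}$ or there is $k$ with $x_t=y_t$ for $t=1,\dots,k-1$ and $x_k>y_k$. The Lexicographic Ranking based on Minimal winning coalitions (LRM) $R_{\mathrm{LRM}}$ is defined by: $i\,R_{\mathrm{LRM}}^v\,j$ iff $\theta_v(i)\ge_L\theta_v(j)$. Its symmetric part is denoted $I_{\mathrm{LRM}}^v$ and its asymmetric part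 $P_{\mathrm{LRM}}^v$. Desirability relation: $i\succeq^v j$ iff for all $S\subseteq N\setminus\{i,j\}$, $S\cup\{j\}\in\mathcal{W}^v$ implies $S\cup\{i\}\in\mathcal{W}^v$. $i\sim^v j$ means $i\succeq^v j$ and $j\succeq^v i$. $i\succ^v j$ means $i\succeq^v j$ and there exists $T\subseteq N\setminus\{i,j\}$ with $T\cup\{i\}\in\mathcal{W}^v$ and $T\cup\{j\}\notin\mathcal{W}^v$. *)

theory Defs
  imports Complex_Main "HOL-Library.FuncSet"
begin

definition players :: "nat \<Rightarrow> nat set" where
  "players n = {1..n}"

(* Only the values of v on subsets of the player set matter; every notion below consults v
   on such sets only. *)
definition simple_games :: "nat \<Rightarrow> (nat set \<Rightarrow> nat) set" where
  "simple_games n = {v. (\<forall>S\<subseteq>players n. v S \<in> {0, 1}) \<and> v {} = 0 \<and> v (players n) = 1 \<and>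
     (\<forall>S T. S \<subseteq> T \<and> T \<subseteq> players n \<longrightarrow> v S \<le> v T)}"

definition winning :: "nat \<Rightarrow> (nat set \<Rightarrow> nat) \<Rightarrow> nat set set" where
  "winning n v = {S. S \<subseteq> players n \<and> v S = 1}"

definition min_winning :: "nat \<Rightarrow> (nat set \<Rightarrow> nat) \<Rightarrow> nat set set" where
  "min_winning n v = {S \<in> winning n v. \<forall>T \<in> winning n v. T \<subseteq> S \<longrightarrow> T = S}"

definition total_preorders :: "nat \<Rightarrow> nat rel set" where
  "total_preorders n = {R. preorder_on (players n) R \<and> total_on (players n) R}"

definition sym_part :: "'a rel \<Rightarrow> 'a rel" where
  "sym_part R = {(x, y). (x, y) \<in> R \<and> (y, x) \<in> R}"

definition asym_part :: "'a rel \<Rightarrow> 'a rel" where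
  "asym_part R = {(x, y). (x, y) \<in> R \<and> (y, x) \<notin> R}"

(* Vectors in real n-space are functions read at the indices 1, ..., n only. *)
definition lex_ge :: "nat \<Rightarrow> (nat \<Rightarrow> real) \<Rightarrow> (nat \<Rightarrow> real) \<Rightarrow> bool" where
  "lex_ge n x y \<longleftrightarrow> (\<forall>t\<in>{1..n}. x t = y t) \<or>
     (\<exists>k\<in>{1..n}. (\<forall>t\<in>{1..<k}. x t = y t) \<and> x k > y k)"

definition theta :: "nat \<Rightarrow> (nat set \<Rightarrow> nat) \<Rightarrow> nat \<Rightarrow> nat \<Rightarrow> real" where
  "theta n v i k = real (card {S \<in> min_winning n v. i \<in> S \<and> card S = k})"

definition LRM :: "nat \<Rightarrow> (nat set \<Rightarrow> nat) \<Rightarrow> nat rel" where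
  "LRM n v = {(i, j). i \<in> players n \<and> j \<in> players n \<and> lex_ge n (theta n v i) (theta n v j)}"

definition desirable :: "nat \<Rightarrow> (nat set \<Rightarrow> nat) \<Rightarrow> nat \<Rightarrow> nat \<Rightarrow> bool" where
  "desirable n v i j \<longleftrightarrow>
     (\<forall>S \<subseteq> players n - {i, j}. S \<union> {j} \<in> winning n v \<longrightarrow> S \<union> {i} \<in> winning n v)"

definition equi_desirable :: "nat \<Rightarrow> (nat set \<Rightarrow> nat) \<Rightarrow> nat \<Rightarrow> nat \<Rightarrow> bool" where
  "equi_desirable n v i j \<longleftrightarrow> desirable n v i j \<and> desirable n v j i"

definition strictly_desirable :: "nat \<Rightarrow> (nat set \<Rightarrow> nat) \<Rightarrow> nat \<Rightarrow> nat \<Rightarrow> bool" where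
  "strictly_desirable n v i j \<longleftrightarrow> desirable n v i j \<and>
     (\<exists>T \<subseteq> players n - {i, j}. T \<union> {i} \<in> winning n v \<and> T \<union> {j} \<notin> winning n v)"

definition desirable_monotonic :: "nat \<Rightarrow> ((nat set \<Rightarrow> nat) \<Rightarrow> nat rel) \<Rightarrow> bool" where
  "desirable_monotonic n R \<longleftrightarrow>
     (\<forall>v \<in> simple_games n. \<forall>i \<in> players n. \<forall>j \<in> players n.
        (equi_desirable n v i j \<longrightarrow> (i, j) \<in> sym_part (R v)) \<and>
        (strictly_desirable n v i j \<longrightarrow> (i, j) \<in> asym_part (R v)))"

end

theory Submission
  imports Defs
begin

text \<open>
  Let \<open>i\<close> be at least as desirable as \<open>j\<close>, \<open>i \<noteq> j\<close>. Minimal winning coalitions containing both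
  players, or neither, do not distinguish \<open>i\<close> from \<open>j\<close>, so one compares the sets \<open>S\<close> avoiding both
  for which \<open>S \<union> {i}\<close>, respectively \<open>S \<union> {j}\<close>, is minimal winning. Call \<open>S\<close> separating if \<open>S \<union> {i}\<close>
  wins and \<open>S \<union> {j}\<close> loses. The two families can only differ because of separating sets: they agree
  below the least cardinality \<open>m\<close> of a separating set, and at cardinality \<open>m\<close> every \<open>S\<close> for \<open>j\<close> is
  one for \<open>i\<close>, while a separating set of size \<open>m\<close> belongs to \<open>i\<close> only. Hence the theta vectors first
  differ at coordinate \<open>m + 1\<close>, in favour of \<open>i\<close>.
\<close>

section \<open>The lexicographic order\<close>

lemma lex_ge_refl: "lex_ge n x x"
  by (simp add: lex_ge_def)

lemma lex_ge_trans:
  assumes "lex_ge n x y" "lex_ge n y z"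
  shows "lex_ge n x z"
proof -
  consider "\<forall>t\<in>{1..n}. x t = y t" | "\<forall>t\<in>{1..n}. y t = z t"
    | k l where "k \<in> {1..n}" "\<forall>t\<in>{1..<k}. x t = y t" "x k > y k"
        "l \<in> {1..n}" "\<forall>t\<in>{1..<l}. y t = z t" "y l > z l"
    using assms unfolding lex_ge_def by blast
  then show ?thesis
  proof cases
    case 1
    then show ?thesis using assms(2) unfolding lex_ge_def by fastforce
  next
    case 2
    then show ?thesis using assms(1) unfolding lex_ge_def by fastforce
  next
    case (3 k l)
    \<comment> \<open>The earlier of the two deciding coordinates decides the composite comparison:
      there one inequality is strict and the other is strict or an equality.\<close>
    have "x (min k l) > z (min k l)"
    proof (cases k l rule: linorder_cases)
      case less
      then have "y k = z k" using 3 by simp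
      then show ?thesis using 3 less by simp
    next
      case equal
      then show ?thesis using 3 by simp
    next
      case greater
      then have "x l = y l" using 3 by simp
      then show ?thesis using 3 greater by simp
    qed
    moreover have "\<forall>t\<in>{1..<min k l}. x t = z t" "min k l \<in> {1..n}"
      using 3 by auto
    ultimately show ?thesis unfolding lex_ge_def by blast
  qed
qed

lemma lex_ge_total: "lex_ge n x y \<or> lex_ge n y x"
proof (cases "\<forall>t\<in>{1..n}. x t = y t")
  case True
  then show ?thesis by (simp add: lex_ge_def)
next
  case False
  then have ex: "\<exists>k. k \<in> {1..n} \<and> x k \<noteq> y k" by blast
  define k where "k = (LEAST k. k \<in> {1..n} \<and> x k \<noteq> y k)"
  have k: "k \<in> {1..n}" "x k \<noteq> y k"
    using LeastI_ex[OF ex] by (auto simp: k_def)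
  have "x t = y t" if "t \<in> {1..<k}" for t
    using that k(1) not_less_Least[of t "\<lambda>k. k \<in> {1..n} \<and> x k \<noteq> y k"] by (auto simp: k_def)
  then show ?thesis
    using k unfolding lex_ge_def by (metis linorder_neqE_linordered_idom)
qed

text \<open>A strict gain at \<open>k\<close> excludes equality, and two vectors have only one first
  differing coordinate. This yields the asymmetric part of the ranking.\<close>

lemma not_lex_ge:
  assumes "k \<in> {1..n}" "\<forall>t\<in>{1..<k}. x t = y t" "x k > y k"
  shows "\<not> lex_ge n y x"
proof
  assume "lex_ge n y x"
  then obtain l where "l \<in> {1..n}" "\<forall>t\<in>{1..<l}. y t = x t" "y l > x l"
    using assms unfolding lex_ge_def by fastforce
  then show False
    using assms by (cases k l rule: linorder_cases) auto
qed

lemma LRM_total_preorder: "LRM n v \<in> total_preorders n"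
proof -
  have "trans (LRM n v)"
    by (rule transI) (auto simp: LRM_def intro: lex_ge_trans)
  then show ?thesis
    using lex_ge_total
    by (auto simp: total_preorders_def preorder_on_def refl_on_def total_on_def LRM_def lex_ge_refl)
qed

section \<open>Minimal winning coalitions and desirability\<close>

text \<open>Removing \<open>i\<close> from the coalitions makes the families for \<open>i\<close>
  and for \<open>j\<close> comparable by inclusion. The index \<open>m\<close> counts the remaining
  players, so it corresponds to coordinate \<open>Suc m\<close> of \<open>theta\<close>.\<close>

definition min_winning_rest :: "nat \<Rightarrow> (nat set \<Rightarrow> nat) \<Rightarrow> nat \<Rightarrow> nat \<Rightarrow> nat \<Rightarrow> nat set set" where
  "min_winning_rest n v i j m =
     {S. S \<subseteq> players n - {i, j} \<and> card S = m \<and> insert i S \<in> min_winning n v}"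

lemma finite_min_winning: "finite (min_winning n v)"
  by (rule finite_subset[of _ "Pow (players n)"])
    (auto simp: min_winning_def winning_def players_def)

lemma finite_min_winning_rest: "finite (min_winning_rest n v i j m)"
  by (rule finite_subset[of _ "Pow (players n)"])
    (auto simp: min_winning_rest_def players_def)

text \<open>Split by membership of \<open>j\<close>; on coalitions without \<open>j\<close>,
  deleting \<open>i\<close> is a bijection onto \<open>min_winning_rest\<close>.\<close>

lemma theta_eq:
  assumes "i \<noteq> j"
  shows "theta n v i (Suc m) =
    real (card {S \<in> min_winning n v. i \<in> S \<and> j \<in> S \<and> card S = Suc m}) +
    real (card (min_winning_rest n v i j m))"
proof -
  let ?B = "{S \<in> min_winning n v. i \<in> S \<and> j \<in> S \<and> card S = Suc m}"
  let ?C = "{S \<in> min_winning n v. i \<in> S \<and> j \<notin> S \<and> card S = Suc m}"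
  have "?C = insert i ` min_winning_rest n v i j m" (is "_ = ?I")
  proof
    show "?C \<subseteq> ?I"
    proof
      fix S assume S: "S \<in> ?C"
      then have "S \<subseteq> players n"
        by (auto simp: min_winning_def winning_def)
      then have "S - {i} \<in> min_winning_rest n v i j m"
        using S by (auto simp: min_winning_rest_def insert_absorb)
      moreover have "S = insert i (S - {i})" using S by auto
      ultimately show "S \<in> ?I" by (rule rev_image_eqI)
    qed
    show "?I \<subseteq> ?C"
    proof
      fix S assume "S \<in> ?I"
      then obtain U where U: "U \<in> min_winning_rest n v i j m" "S = insert i U" by auto
      moreover have "finite U"
        using U by (auto simp: min_winning_rest_def players_def intro: finite_subset)
      ultimately show "S \<in> ?C"
        using assms by (auto simp: min_winning_rest_def card_insert_if)
    qed
  qed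
  moreover have "inj_on (insert i) (min_winning_rest n v i j m)"
    by (rule inj_onI) (metis (no_types, lifting) Diff_iff insert_ident insertI1
        mem_Collect_eq min_winning_rest_def subsetD)
  ultimately have C: "card ?C = card (min_winning_rest n v i j m)"
    by (simp add: card_image)
  have "{S \<in> min_winning n v. i \<in> S \<and> card S = Suc m} = ?B \<union> ?C" by auto
  moreover have "card (?B \<union> ?C) = card ?B + card ?C"
    using finite_min_winning by (intro card_Un_disjoint) auto
  ultimately show ?thesis by (simp add: theta_def C)
qed

text \<open>The number of coalitions containing both players is symmetric in them and
  cancels.\<close>

lemma theta_compare:
  assumes "i \<noteq> j"
  shows theta_less_iff: "theta n v j (Suc m) < theta n v i (Suc m) \<longleftrightarrow>
      card (min_winning_rest n v j i m) < card (min_winning_rest n v i j m)"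
    and theta_eq_iff: "theta n v i (Suc m) = theta n v j (Suc m) \<longleftrightarrow>
      card (min_winning_rest n v i j m) = card (min_winning_rest n v j i m)"
proof -
  have "{S \<in> min_winning n v. j \<in> S \<and> i \<in> S \<and> card S = Suc m} =
      {S \<in> min_winning n v. i \<in> S \<and> j \<in> S \<and> card S = Suc m}"
    by blast
  then have "theta n v j (Suc m) =
      real (card {S \<in> min_winning n v. i \<in> S \<and> j \<in> S \<and> card S = Suc m}) +
      real (card (min_winning_rest n v j i m))"
    using theta_eq[of j i n v m] assms by simp
  then show "theta n v j (Suc m) < theta n v i (Suc m) \<longleftrightarrow>
      card (min_winning_rest n v j i m) < card (min_winning_rest n v i j m)"
    and "theta n v i (Suc m) = theta n v j (Suc m) \<longleftrightarrow>
      card (min_winning_rest n v i j m) = card (min_winning_rest n v j i m)"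
    using theta_eq[OF assms, of n v m] by simp_all
qed

lemma winning_mono:
  assumes "v \<in> simple_games n" "S \<in> winning n v" "S \<subseteq> T" "T \<subseteq> players n"
  shows "T \<in> winning n v"
proof -
  have "v S \<le> v T" "v T \<in> {0, 1}"
    using assms by (auto simp: simple_games_def)
  then show ?thesis using assms by (auto simp: winning_def)
qed

text \<open>A subset of \<open>insert i S\<close> either avoids \<open>i\<close> or is
  \<open>insert i U\<close> with \<open>U\<close> inside \<open>S\<close>. The condition on subsets
  avoiding \<open>i\<close> does not mention \<open>i\<close>, so it carries over unchanged when
  \<open>i\<close> is exchanged for \<open>j\<close>.\<close>

lemma insert_in_min_winning_iff:
  assumes "i \<notin> S"
  shows "insert i S \<in> min_winning n v \<longleftrightarrow>
    insert i S \<in> winning n v \<and> (\<forall>U\<subseteq>S. U \<notin> winning n v) \<and>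
    (\<forall>U. U \<subset> S \<longrightarrow> insert i U \<notin> winning n v)" (is "?L \<longleftrightarrow> ?R")
proof
  assume L: ?L
  have "U \<notin> winning n v" if "U \<subseteq> S" for U
    using L that assms by (auto simp: min_winning_def)
  moreover have "insert i U \<notin> winning n v" if "U \<subset> S" for U
  proof
    assume "insert i U \<in> winning n v"
    then have "insert i U = insert i S"
      using L that by (auto simp: min_winning_def)
    then show False using that assms by auto
  qed
  ultimately show ?R using L by (auto simp: min_winning_def)
next
  assume R: ?R
  have "T = insert i S" if "T \<in> winning n v" "T \<subseteq> insert i S" for T
  proof -
    have i: "i \<in> T" using R that by blast
    then have "insert i (T - {i}) \<in> winning n v"
      using that by (simp add: insert_absorb)
    then have "\<not> T - {i} \<subset> S" using R by blast
    then have "T - {i} = S" using that by blast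
    then show ?thesis using i by blast
  qed
  then show ?L using R by (auto simp: min_winning_def)
qed

section \<open>Separating sets\<close>

definition separating :: "nat \<Rightarrow> (nat set \<Rightarrow> nat) \<Rightarrow> nat \<Rightarrow> nat \<Rightarrow> nat set \<Rightarrow> bool" where
  "separating n v i j S \<longleftrightarrow>
     S \<subseteq> players n - {i, j} \<and> insert i S \<in> winning n v \<and> insert j S \<notin> winning n v"

lemma desirable_insert:
  assumes "desirable n v i j" "S \<subseteq> players n - {i, j}" "insert j S \<in> winning n v"
  shows "insert i S \<in> winning n v"
  using assms by (simp add: desirable_def)

text \<open>Desirability keeps the coalition winning after the exchange. If minimality failed, some
  proper subset \<open>U\<close> of \<open>S\<close> would be separating, with fewer than
  \<open>m\<close> elements.\<close>

lemma min_winning_rest_subset: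
  assumes "desirable n v i j" "\<And>S. separating n v i j S \<Longrightarrow> m \<le> card S"
  shows "min_winning_rest n v j i m \<subseteq> min_winning_rest n v i j m"
proof
  fix S assume S: "S \<in> min_winning_rest n v j i m"
  then have sub: "S \<subseteq> players n - {i, j}" "i \<notin> S" "j \<notin> S" and card: "card S = m"
    and min: "insert j S \<in> min_winning n v"
    by (auto simp: min_winning_rest_def)
  have fin: "finite S" using sub by (auto simp: players_def intro: finite_subset)
  note min' = min[unfolded insert_in_min_winning_iff[OF sub(3)]]
  have "insert i U \<notin> winning n v" if U: "U \<subset> S" for U
  proof
    assume "insert i U \<in> winning n v"
    then have "separating n v i j U"
      using U sub min' by (auto simp: separating_def)
    then have "m \<le> card U" by (rule assms(2))
    then show False using psubset_card_mono[OF fin U] card by simp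
  qed
  moreover have "insert i S \<in> winning n v"
    using desirable_insert[OF assms(1) sub(1)] min' by simp
  ultimately show "S \<in> min_winning_rest n v i j m"
    using sub card min' by (auto simp: min_winning_rest_def insert_in_min_winning_iff)
qed

text \<open>For the reverse inclusion, the strict bound says that \<open>S\<close> itself is not
  separating, so \<open>insert j S\<close> wins; minimality passes from \<open>i\<close> to
  \<open>j\<close> by desirability.\<close>

lemma min_winning_rest_eq:
  assumes "desirable n v i j" "\<And>S. separating n v i j S \<Longrightarrow> m < card S"
  shows "min_winning_rest n v j i m = min_winning_rest n v i j m"
proof
  show "min_winning_rest n v j i m \<subseteq> min_winning_rest n v i j m"
    using assms by (intro min_winning_rest_subset) (auto simp: less_imp_le)
  show "min_winning_rest n v i j m \<subseteq> min_winning_rest n v j i m"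
  proof
    fix S assume S: "S \<in> min_winning_rest n v i j m"
    then have sub: "S \<subseteq> players n - {i, j}" "i \<notin> S" "j \<notin> S" and card: "card S = m"
      and min: "insert i S \<in> min_winning n v"
      by (auto simp: min_winning_rest_def)
    note min' = min[unfolded insert_in_min_winning_iff[OF sub(2)]]
    have "insert j S \<in> winning n v"
      using assms(2)[of S] sub card min' by (auto simp: separating_def)
    moreover have "insert j U \<notin> winning n v" if "U \<subset> S" for U
      using desirable_insert[OF assms(1), of U] that sub min' by blast
    ultimately show "S \<in> min_winning_rest n v j i m"
      using sub card min' by (auto simp: min_winning_rest_def insert_in_min_winning_iff)
  qed
qed

lemma least_separating_in_min_winning_rest:
  assumes v: "v \<in> simple_games n" and T: "separating n v i j T" and "j \<in> players n"
    and least: "\<And>S. separating n v i j S \<Longrightarrow> card T \<le> card S"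
  shows "T \<in> min_winning_rest n v i j (card T)" "T \<notin> min_winning_rest n v j i (card T)"
proof -
  have sub: "T \<subseteq> players n - {i, j}" "i \<notin> T" "j \<notin> T" and win: "insert i T \<in> winning n v"
    and lose: "insert j T \<notin> winning n v"
    using T by (auto simp: separating_def)
  have fin: "finite T" using sub by (auto simp: players_def intro: finite_subset)
  \<comment> \<open>One appeal to monotonicity serves both the subsets of \<open>T\<close> and the
    sets \<open>insert j U\<close> with \<open>U\<close> inside \<open>T\<close>.\<close>
  have up: "U \<notin> winning n v" if "U \<subseteq> insert j T" for U
    using winning_mono[OF v _ that] lose sub assms(3) by blast
  have "insert i U \<notin> winning n v" if U: "U \<subset> T" for U
  proof
    assume "insert i U \<in> winning n v"
    then have "separating n v i j U"
      using U sub up[of "insert j U"] by (auto simp: separating_def)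
    then have "card T \<le> card U" by (rule least)
    then show False using psubset_card_mono[OF fin U] by simp
  qed
  moreover have "\<forall>U\<subseteq>T. U \<notin> winning n v" using up by blast
  ultimately show "T \<in> min_winning_rest n v i j (card T)"
    using sub win by (simp add: min_winning_rest_def insert_in_min_winning_iff)
  show "T \<notin> min_winning_rest n v j i (card T)"
    using lose by (simp add: min_winning_rest_def min_winning_def)
qed

section \<open>Comparison of the theta vectors\<close>

lemma equi_desirable_theta_eq:
  assumes "equi_desirable n v i j" "t \<ge> 1"
  shows "theta n v i t = theta n v j t"
proof (cases "i = j")
  case False
  obtain m where t: "t = Suc m" using assms(2) by (cases t) auto
  \<comment> \<open>Without separating sets the bound in \<open>min_winning_rest_eq\<close> holds
    vacuously for every \<open>m\<close>.\<close>
  have "\<not> separating n v i j S" for S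
    using assms(1) desirable_insert[of n v j i S]
    by (auto simp: equi_desirable_def separating_def insert_commute)
  then have "min_winning_rest n v j i m = min_winning_rest n v i j m"
    using assms(1) by (intro min_winning_rest_eq) (auto simp: equi_desirable_def)
  then show ?thesis by (simp add: t theta_eq_iff[OF False])
qed simp

lemma strictly_desirable_theta:
  assumes v: "v \<in> simple_games n" and "i \<in> players n" "j \<in> players n"
    and sd: "strictly_desirable n v i j"
  shows "\<exists>k\<in>{1..n}. (\<forall>t\<in>{1..<k}. theta n v i t = theta n v j t) \<and> theta n v i k > theta n v j k"
proof -
  have des: "desirable n v i j" and "\<exists>T. separating n v i j T"
    using sd by (auto simp: strictly_desirable_def separating_def)
  then obtain T where T: "separating n v i j T"
    and least: "\<And>S. separating n v i j S \<Longrightarrow> card T \<le> card S"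
    using ex_has_least_nat[of "separating n v i j" _ card] by blast
  let ?m = "card T"
  have ij: "i \<noteq> j" using T by (auto simp: separating_def)
  \<comment> \<open>\<open>T\<close> omits the player \<open>i\<close>, so the deciding coordinate
    \<open>Suc ?m\<close> is still at most \<open>n\<close>.\<close>
  have "T \<subset> players n"
    using T assms(2) by (auto simp: separating_def)
  then have "?m < n"
    using psubset_card_mono[of "players n" T] by (simp add: players_def)
  moreover have "theta n v i t = theta n v j t" if below: "t \<in> {1..<Suc ?m}" for t
  proof -
    obtain m where t: "t = Suc m" using below by (cases t) auto
    then have m: "m < ?m" using below by simp
    have "min_winning_rest n v j i m = min_winning_rest n v i j m"
      using des least m by (intro min_winning_rest_eq) (auto intro: less_le_trans)
    then show ?thesis by (simp add: t theta_eq_iff[OF ij])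
  qed
  \<comment> \<open>The set \<open>T\<close> witnesses strictness.\<close>
  moreover have "min_winning_rest n v j i ?m \<subset> min_winning_rest n v i j ?m"
    using min_winning_rest_subset[OF des least]
      least_separating_in_min_winning_rest[OF v T assms(3) least] by blast
  then have "theta n v j (Suc ?m) < theta n v i (Suc ?m)"
    by (simp add: theta_less_iff[OF ij] psubset_card_mono finite_min_winning_rest)
  ultimately show ?thesis by (intro bexI[of _ "Suc ?m"]) auto
qed

theorem proposition1:
  fixes n :: nat
  shows "LRM n \<in> simple_games n \<rightarrow> total_preorders n \<and> desirable_monotonic n (LRM n)"
proof
  show "LRM n \<in> simple_games n \<rightarrow> total_preorders n"
    using LRM_total_preorder by blast
  show "desirable_monotonic n (LRM n)"
    unfolding desirable_monotonic_def
  proof (intro ballI conjI impI)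
    fix v i j
    assume v: "v \<in> simple_games n" and ij: "i \<in> players n" "j \<in> players n"
    show "(i, j) \<in> sym_part (LRM n v)" if "equi_desirable n v i j"
      using equi_desirable_theta_eq[OF that] ij
      by (auto simp: sym_part_def LRM_def lex_ge_def)
    show "(i, j) \<in> asym_part (LRM n v)" if "strictly_desirable n v i j"
    proof -
      obtain k where k: "k \<in> {1..n}" "\<forall>t\<in>{1..<k}. theta n v i t = theta n v j t"
        "theta n v i k > theta n v j k"
        using strictly_desirable_theta[OF v ij \<open>strictly_desirable n v i j\<close>] by blast
      then have "lex_ge n (theta n v i) (theta n v j)" unfolding lex_ge_def by blast
      with not_lex_ge[OF k] ij show ?thesis
        by (simp add: asym_part_def LRM_def)
    qed
  qed
qed

end
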